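(* Given $\alpha\in(1,2)$ and $\epsilon>0$, there is a matrix $A\in M_2(\mathbb{Z})$ with determinant $d\ge 2$ and eigenvalues $\lambda,\mu$ with $\lambda>1>\mu$ such that $\left|\bigl(2+\log_\lambda(\mu)\bigr)-\alpha\right|<\epsilon$.
   Context: $M_2(\mathbb{Z})$ is the set of $2\times 2$ matrices with integer entries. The eigenvalues $\lambda,\mu$ are real, and since $\lambda\mu=d>0$ the logarithm $\log_\lambda(\mu)$ is defined. *)

theory Defs
  imports Complex_Main "Jordan_Normal_Form.Determinant" "Jordan_Normal_Form.Char_Poly"
begin

end

theory Submission
  imports Defs "HOL-Real_Asymp.Real_Asymp"
begin

text \<open>
  For a matrix with trace \<open>t\<close> and determinant \<open>d\<close> the relation \<open>\<lambda> \<mu> = d\<close> gives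
  \<open>2 + log\<^sub>\<lambda> \<mu> = 1 + ln d / ln \<lambda>\<close>, so the task is to bring \<open>ln d / ln \<lambda>\<close> close to
  \<open>\<beta> = \<alpha> - 1\<close>, which lies strictly between 0 and 1. As soon as \<open>t > d + 1\<close>, the characteristic
  polynomial \<open>x\<^sup>2 - t x + d\<close> is negative at 1, hence \<open>0 < \<mu> < 1\<close> and the large root
  \<open>\<lambda> = t - \<mu>\<close> is within 1 of the trace (\<open>root_bounds\<close>). So \<open>\<lambda>\<close> behaves like \<open>t\<close>, and
  taking \<open>d = \<lfloor>t\<^sup>\<beta>\<rfloor>\<close> makes the quotient of logarithms tend to \<open>\<beta>\<close> as \<open>t\<close> grows;
  \<open>t > d + 1\<close> holds for large \<open>t\<close> because \<open>\<beta> < 1\<close>, and \<open>d \<ge> 2\<close> because \<open>\<beta> > 0\<close>.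
  Every pair \<open>(t, d)\<close> is realised by a companion matrix.
\<close>

definition companion2 :: "'a::comm_ring_1 \<Rightarrow> 'a \<Rightarrow> 'a mat" where
  "companion2 t d =
    mat 2 2 (\<lambda>(i, j). if i = 0 then (if j = 0 then t else - d) else (if j = 0 then 1 else 0))"

lemma companion2_carrier: "companion2 t d \<in> carrier_mat 2 2"
  by (simp add: companion2_def)

lemma det_companion2: "det (companion2 t d) = d"
proof -
  have minor: "det (mat_delete (companion2 t d) 1 0) = - d"
    by (subst det_single) (simp_all add: companion2_def mat_delete_def)
  have "det (companion2 t d) =
      (\<Sum>j<2. companion2 t d $$ (1, j) * cofactor (companion2 t d) 1 j)"
    by (rule laplace_expansion_row[OF companion2_carrier]) simp
  also have "\<dots> = cofactor (companion2 t d) 1 0"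
    by (simp add: numeral_2_eq_2 companion2_def)
  also have "\<dots> = d"
    using minor by (simp add: cofactor_def)
  finally show ?thesis .
qed

lemma map_mat_companion2:
  "map_mat real_of_int (companion2 t d) = companion2 (real_of_int t) (real_of_int d)"
  by (rule eq_matI) (auto simp: companion2_def)

text \<open>A root \<open>x\<close> of the characteristic polynomial has the eigenvector \<open>(x, 1)\<close>.\<close>

lemma eigenvalue_companion2:
  fixes x :: "'a::field"
  assumes "x\<^sup>2 = t * x - d"
  shows "eigenvalue (companion2 t d) x"
proof -
  have "companion2 t d *\<^sub>v vec_of_list [x, 1] = x \<cdot>\<^sub>v vec_of_list [x, 1]"
    using assms
    by (intro eq_vecI)
       (auto simp: companion2_def less_Suc_eq scalar_prod_def power2_eq_square numeral_2_eq_2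
         vec_of_list_index)
  moreover have "vec_of_list [x, 1] \<noteq> 0\<^sub>v 2"
  proof
    assume "vec_of_list [x, 1] = 0\<^sub>v 2"
    then have "vec_of_list [x, 1] $ 1 = 0\<^sub>v 2 $ 1" by simp
    then show False by (simp add: vec_of_list_index)
  qed
  moreover have "vec_of_list [x, 1] \<in> carrier_vec 2" by (simp add: carrier_vecI)
  moreover have "dim_row (companion2 t d) = 2"
    using companion2_carrier by blast
  ultimately show ?thesis
    unfolding eigenvalue_def eigenvector_def by auto
qed

text \<open>
  The discriminant exceeds \<open>(t - 2)\<^sup>2\<close> because \<open>d < t - 1\<close>, and is below \<open>t\<^sup>2\<close> because
  \<open>d > 0\<close>; this confines the small root to \<open>(0, 1)\<close>.
\<close>

lemma root_bounds:
  fixes t d :: real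
  assumes "2 \<le> t" "0 < d" "d + 1 < t"
  obtains l m where "l + m = t" "l * m = d" "0 < m" "m < 1"
proof
  define s where "s = sqrt (t\<^sup>2 - 4 * d)"
  have lower: "(t - 2)\<^sup>2 < t\<^sup>2 - 4 * d"
    using assms by (simp add: power2_eq_square algebra_simps)
  have "t - 2 < s"
    unfolding s_def using lower by (rule real_less_rsqrt)
  then show "(t - s) / 2 < 1" by simp
  have "s < t"
    unfolding s_def using assms by (intro real_less_lsqrt) auto
  then show "0 < (t - s) / 2" by simp
  have "0 \<le> t\<^sup>2 - 4 * d"
    using lower zero_le_power2[of "t - 2"] by linarith
  then have "s\<^sup>2 = t\<^sup>2 - 4 * d"
    unfolding s_def by simp
  then show "(t + s) / 2 * ((t - s) / 2) = d"
    by (simp add: power2_eq_square field_simps)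
  show "(t + s) / 2 + (t - s) / 2 = t" by (simp add: field_simps)
qed

text \<open>
  A factor of 2 in either \<open>d\<close> or \<open>l\<close> only shifts a logarithm by \<open>ln 2\<close>, which is negligible
  against \<open>ln t\<close>; such crude estimates absorb both the rounding of \<open>t\<^sup>\<beta>\<close> and the
  difference between \<open>l\<close> and \<open>t\<close>.
\<close>

lemma log_quotient_bounds:
  fixes t d l \<beta> :: real
  assumes "2 < t" "t powr \<beta> / 2 \<le> d" "d \<le> t powr \<beta>" "1 \<le> d" "t / 2 \<le> l" "l \<le> t"
  shows "(\<beta> * ln t - ln 2) / ln t \<le> ln d / ln l"
    and "ln d / ln l \<le> \<beta> * ln t / (ln t - ln 2)"
proof -
  have "0 < t powr \<beta> / 2" using assms(1) by simp
  then have "ln (t powr \<beta> / 2) \<le> ln d"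
    using assms by (subst ln_le_cancel_iff) auto
  then have d_lower: "\<beta> * ln t - ln 2 \<le> ln d"
    using assms(1) by (simp add: ln_div ln_powr)
  have "ln d \<le> ln (t powr \<beta>)"
    using assms by (subst ln_le_cancel_iff) auto
  then have d_upper: "ln d \<le> \<beta> * ln t"
    using assms(1) by (simp add: ln_powr)
  have "ln (t / 2) \<le> ln l"
    using assms by (subst ln_le_cancel_iff) auto
  then have l_lower: "ln t - ln 2 \<le> ln l"
    using assms(1) by (simp add: ln_div)
  have l_upper: "ln l \<le> ln t"
    using assms by (subst ln_le_cancel_iff) auto
  have pos: "0 < ln t - ln 2"
    using assms(1) by simp
  have d_nonneg: "0 \<le> ln d"
    using assms(4) by simp
  have "(\<beta> * ln t - ln 2) / ln t \<le> ln d / ln t"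
    using d_lower assms(1) by (intro divide_right_mono) auto
  also have "\<dots> \<le> ln d / ln l"
    using d_nonneg pos l_lower l_upper by (intro divide_left_mono) auto
  finally show "(\<beta> * ln t - ln 2) / ln t \<le> ln d / ln l" .
  show "ln d / ln l \<le> \<beta> * ln t / (ln t - ln 2)"
    using d_nonneg d_upper pos l_lower by (intro frac_le) auto
qed

lemma exists_trace:
  fixes \<beta> \<epsilon> :: real
  assumes "0 < \<beta>" "\<beta> < 1" "0 < \<epsilon>"
  obtains n :: nat where "4 \<le> n" "2 \<le> real n powr \<beta>" "real n powr \<beta> + 1 < real n"
    "\<beta> - \<epsilon> < (\<beta> * ln (real n) - ln 2) / ln (real n)"
    "\<beta> * ln (real n) / (ln (real n) - ln 2) < \<beta> + \<epsilon>"
proof -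
  have lower: "(\<lambda>n. (\<beta> * ln (real n) - ln 2) / ln (real n)) \<longlonglongrightarrow> \<beta>"
    by real_asymp
  have upper: "(\<lambda>n. \<beta> * ln (real n) / (ln (real n) - ln 2)) \<longlonglongrightarrow> \<beta>"
    using assms by real_asymp
  have "eventually (\<lambda>n. \<beta> - \<epsilon> < (\<beta> * ln (real n) - ln 2) / ln (real n)) sequentially"
    using order_tendstoD(1)[OF lower] assms by simp
  moreover have "eventually (\<lambda>n. \<beta> * ln (real n) / (ln (real n) - ln 2) < \<beta> + \<epsilon>) sequentially"
    using order_tendstoD(2)[OF upper] assms by simp
  moreover have "eventually (\<lambda>n. 2 \<le> real n powr \<beta>) sequentially"
    using assms by real_asymp
  moreover have "eventually (\<lambda>n. real n powr \<beta> + 1 < real n) sequentially"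
    using assms by real_asymp
  ultimately have "eventually (\<lambda>n. 4 \<le> n \<and> 2 \<le> real n powr \<beta> \<and> real n powr \<beta> + 1 < real n \<and>
      \<beta> - \<epsilon> < (\<beta> * ln (real n) - ln 2) / ln (real n) \<and>
      \<beta> * ln (real n) / (ln (real n) - ln 2) < \<beta> + \<epsilon>) sequentially"
    using eventually_ge_at_top[of 4] by eventually_elim auto
  then show thesis
    using that by (auto simp: eventually_sequentially)
qed

theorem proposition7p3:
  fixes \<alpha> \<epsilon> :: real
  assumes "1 < \<alpha>" and "\<alpha> < 2" and "\<epsilon> > 0"
  shows "\<exists>A :: int mat. A \<in> carrier_mat 2 2 \<and> det A \<ge> 2 \<and>
    (\<exists>l m :: real.
        eigenvalue (map_mat real_of_int A) l \<and>
        eigenvalue (map_mat real_of_int A) m \<and>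
        l > 1 \<and> 1 > m \<and>
        \<bar>(2 + log l m) - \<alpha>\<bar> < \<epsilon>)"
proof -
  define \<beta> where "\<beta> = \<alpha> - 1"
  have "0 < \<beta>" "\<beta> < 1" using assms by (auto simp: \<beta>_def)
  then obtain n :: nat where n: "4 \<le> n" "2 \<le> real n powr \<beta>" "real n powr \<beta> + 1 < real n"
    "\<beta> - \<epsilon> < (\<beta> * ln (real n) - ln 2) / ln (real n)"
    "\<beta> * ln (real n) / (ln (real n) - ln 2) < \<beta> + \<epsilon>"
    using exists_trace assms(3) by blast
  define t d where "t = int n" and "d = \<lfloor>real n powr \<beta>\<rfloor>"
  have "2 \<le> d" using n(2) by (simp add: d_def le_floor_iff)
  have d_upper: "real_of_int d \<le> real n powr \<beta>" by (simp add: d_def)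
  \<comment> \<open>Since \<open>n powr \<beta> \<ge> 2\<close>, rounding down loses at most half of it.\<close>
  have d_lower: "real n powr \<beta> / 2 \<le> real_of_int d"
    using n(2) unfolding d_def by linarith
  obtain l m where lm: "l + m = real n" "l * m = real_of_int d" "0 < m" "m < 1"
    using root_bounds[of "real n" "real_of_int d"] n(1,3) \<open>2 \<le> d\<close> d_upper by auto
  have l: "real n / 2 \<le> l" "l \<le> real n" "1 < l"
    using lm n(1) by auto
  let ?A = "companion2 t d"
  have "l\<^sup>2 = real_of_int t * l - real_of_int d" "m\<^sup>2 = real_of_int t * m - real_of_int d"
    unfolding t_def lm(2)[symmetric] using lm(1)[symmetric]
    by (simp_all add: power2_eq_square algebra_simps)
  then have eig: "eigenvalue (map_mat real_of_int ?A) l" "eigenvalue (map_mat real_of_int ?A) m"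
    unfolding map_mat_companion2 by (auto intro: eigenvalue_companion2)
  have "ln (real_of_int d) = ln l + ln m"
    using lm(2)[symmetric] lm(3) l(3) by (simp add: ln_mult)
  then have "2 + log l m - \<alpha> = ln (real_of_int d) / ln l - \<beta>"
    using l(3) by (simp add: log_def \<beta>_def field_simps)
  moreover have "\<bar>ln (real_of_int d) / ln l - \<beta>\<bar> < \<epsilon>"
    using log_quotient_bounds[of "real n" \<beta> "real_of_int d" l] n d_lower d_upper \<open>2 \<le> d\<close> l
    by (auto simp: abs_less_iff)
  ultimately have "\<bar>(2 + log l m) - \<alpha>\<bar> < \<epsilon>" by simp
  moreover have "det ?A \<ge> 2" using \<open>2 \<le> d\<close> by (simp add: det_companion2)
  ultimately show ?thesis
    using companion2_carrier[of t d] eig lm(4) l(3) by blast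
qed

end
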